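(* Let $X$ be a topological vector space with the Borel $\sigma$-algebra and a measure $\mu$ on it. Assume that 1) for any nonempty open set $S\subset X$ one has $\mu(S)>0$; 2) $Y$ is a locally convex Hausdorff space; 3) a mapping $f:X\to Y$ is continuous at a point $\tilde x\in X$. Then $$\bigcap_{U\in\mathcal U}\ \bigcap_{\mu(N)=0}\mathrm{conv}\, f(U\setminus N)=\{f(\tilde x)\},$$ where $\mathcal U$ is a base of open neighbourhoods of the point $\tilde x$ and the inner intersection is taken over all measurable sets $N\subset X$ with $\mu(N)=0$.
   Context: $\mathrm{conv}$ denotes the closed convex hull. Measures take values in $[0,\infty]$. The function $f$ is not assumed to be measurable. "Locally convex Hausdorff space" means a locally convex Hausdorff topological vector space. *)

theory Defs
  imports "HOL-Analysis.Analysis"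
begin

text \<open>Real topological vector spaces; no separation axiom is included. Joint continuity of the
  scalar multiplication is stated in the style of the library class for topological monoids.\<close>

class real_tvs = real_vector + topological_ab_group_add +
  assumes tendsto_scaleR_Pair: "LIM x (nhds c \<times>\<^sub>F nhds a). fst x *\<^sub>R snd x :> nhds (c *\<^sub>R a)"

instance real_normed_vector \<subseteq> real_tvs
proof
  fix c :: real and a :: 'a
  show "LIM x (nhds c \<times>\<^sub>F nhds a). fst x *\<^sub>R snd x :> nhds (c *\<^sub>R a)"
    by (intro tendsto_scaleR filterlim_fst filterlim_snd)
qed

definition closed_convex_hull :: "'a::real_tvs set \<Rightarrow> 'a set"
  where "closed_convex_hull S = closure (convex hull S)"

definition open_nhds_base :: "'a::topological_space \<Rightarrow> 'a set set \<Rightarrow> bool"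
  where "open_nhds_base x \<U> \<longleftrightarrow>
    (\<forall>U\<in>\<U>. open U \<and> x \<in> U) \<and> (\<forall>S. open S \<and> x \<in> S \<longrightarrow> (\<exists>U\<in>\<U>. U \<subseteq> S))"

end

theory Submission
  imports Defs
begin

text \<open>A null set contains no nonempty open set, so every neighbourhood of \<open>x\<close> retains, after
  removal of a null set, points whose values are arbitrarily close to \<open>f x\<close>. Conversely, a convex
  neighbourhood of \<open>f x\<close> separated from \<open>y\<close> by an open set contains the convex hull of the image
  of a small neighbourhood of \<open>x\<close>; the empty null set already excludes \<open>y\<close>.\<close>

lemma topological_limit_at_pointE:
  assumes "(f \<longlongrightarrow> f x) (at x)" "open W" "f x \<in> W"
  obtains S where "open S" "x \<in> S" "f ` S \<subseteq> W"
proof -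
  have "\<forall>\<^sub>F y in at x. f y \<in> W"
    using assms by (rule topological_tendstoD)
  then obtain S where "open S" "x \<in> S" "\<forall>y\<in>S. y \<noteq> x \<longrightarrow> f y \<in> W"
    unfolding eventually_at_topological by blast
  \<comment> \<open>The filter \<open>at x\<close> is punctured; the point \<open>x\<close> itself
    is covered by \<open>f x \<in> W\<close>.\<close>
  moreover have "f ` S \<subseteq> W"
    using assms(3) calculation(3) by auto
  ultimately show thesis using that by simp
qed

text \<open>The value \<open>f x\<close> already lies in the closure of the image itself, before any
  convex combinations are formed.\<close>

lemma in_closed_convex_hull_image_diff_null:
  assumes pos: "\<And>S. open S \<Longrightarrow> S \<noteq> {} \<Longrightarrow> emeasure \<mu> S > 0"
    and lim: "(f \<longlongrightarrow> f x) (at x)"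
    and U: "open U" "x \<in> U"
    and N: "N \<in> sets \<mu>" "emeasure \<mu> N = 0"
  shows "f x \<in> closed_convex_hull (f ` (U - N))"
proof -
  have "f x \<in> closure (f ` (U - N))"
    unfolding closure_iff_nhds_not_empty
  proof (intro allI impI)
    fix A W assume "W \<subseteq> A" "open W" "f x \<in> W"
    obtain S where S: "open S" "x \<in> S" "f ` S \<subseteq> W"
      using topological_limit_at_pointE[OF lim \<open>open W\<close> \<open>f x \<in> W\<close>] .
    have "emeasure \<mu> (S \<inter> U) > 0"
      using S U by (intro pos) auto
    \<comment> \<open>Otherwise monotonicity would bound the positive measure of
      \<open>S \<inter> U\<close> by that of \<open>N\<close>, which is 0.\<close>
    then have "\<not> S \<inter> U \<subseteq> N"
      using emeasure_mono[OF _ N(1)] N(2) by fastforce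
    then show "f ` (U - N) \<inter> A \<noteq> {}"
      using S(3) \<open>W \<subseteq> A\<close> by blast
  qed
  moreover have "closure (f ` (U - N)) \<subseteq> closed_convex_hull (f ` (U - N))"
    unfolding closed_convex_hull_def by (intro closure_mono hull_subset)
  ultimately show ?thesis by blast
qed

text \<open>Hulls and closures are monotone, so one \<open>S\<close> serves all its subsets, in
  particular any member of a base inside it.\<close>

lemma exists_nhds_notin_closed_convex_hull_image:
  fixes f :: "'a::topological_space \<Rightarrow> 'b::{real_tvs, t2_space}"
  assumes lc: "locally convex (UNIV :: 'b set)"
    and lim: "(f \<longlongrightarrow> f x) (at x)"
    and "y \<noteq> f x"
  obtains S where "open S" "x \<in> S" "\<And>T. T \<subseteq> S \<Longrightarrow> y \<notin> closed_convex_hull (f ` T)"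
proof -
  obtain A B where AB: "open A" "open B" "f x \<in> A" "y \<in> B" "A \<inter> B = {}"
    using hausdorff[of "f x" y] \<open>y \<noteq> f x\<close> by blast
  have "openin (top_of_set UNIV) A"
    using AB(1) by simp
  \<comment> \<open>\<open>C\<close> need not be open and \<open>V\<close> need not be convex:
    \<open>V\<close> is used for the limit, \<open>C\<close> for the hull.\<close>
  then obtain V C where "openin (top_of_set UNIV) V" and C: "convex C"
    and V: "f x \<in> V" "V \<subseteq> C" and "C \<subseteq> A"
    using AB(3) by (rule locallyE[OF lc])
  then have "open V"
    by simp
  obtain S where S: "open S" "x \<in> S" "f ` S \<subseteq> V"
    using topological_limit_at_pointE[OF lim \<open>open V\<close> V(1)] .
  have "y \<notin> closed_convex_hull (f ` T)" if "T \<subseteq> S" for T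
  proof -
    have "convex hull (f ` T) \<subseteq> A"
      using hull_minimal[of "f ` T" C convex] that S(3) V(2) C \<open>C \<subseteq> A\<close> by blast
    \<comment> \<open>An open set disjoint from the hull is disjoint from its closure, so
      \<open>B\<close> keeps \<open>y\<close> out of the closed hull too.\<close>
    then have "B \<inter> convex hull (f ` T) = {}"
      using AB(5) by blast
    then show ?thesis
      unfolding closed_convex_hull_def
      using open_Int_closure_eq_empty[OF AB(2)] AB(4) by blast
  qed
  with S(1,2) show thesis
    by (rule that)
qed

theorem theorem5:
  fixes \<mu> :: "'a::real_tvs measure"
    and f :: "'a \<Rightarrow> 'b::{real_tvs, t2_space}"
    and x :: 'a
    and \<U> :: "'a set set"
  assumes "sets \<mu> = sets borel"
    and "\<And>S. open S \<Longrightarrow> S \<noteq> {} \<Longrightarrow> emeasure \<mu> S > 0"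
    and "locally convex (UNIV :: 'b set)"
    and "(f \<longlongrightarrow> f x) (at x)"
    and "open_nhds_base x \<U>"
  shows "(\<Inter>U\<in>\<U>. \<Inter>N\<in>{N \<in> sets \<mu>. emeasure \<mu> N = 0}. closed_convex_hull (f ` (U - N))) = {f x}"
    (is "?I = _")
proof (intro equalityI subsetI)
  fix y assume "y \<in> {f x}"
  then have "y = f x" by simp
  then show "y \<in> ?I"
    using in_closed_convex_hull_image_diff_null[OF assms(2,4)] assms(5)
    by (auto simp: open_nhds_base_def)
next
  fix y assume y: "y \<in> ?I"
  show "y \<in> {f x}"
  proof (rule ccontr)
    assume "y \<notin> {f x}"
    then obtain S where S: "open S" "x \<in> S" "\<And>T. T \<subseteq> S \<Longrightarrow> y \<notin> closed_convex_hull (f ` T)"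
      using exists_nhds_notin_closed_convex_hull_image[OF assms(3,4)] by blast
    \<comment> \<open>\<open>S\<close> itself need not belong to \<open>\<U>\<close>, hence the
      passage to a smaller base member.\<close>
    obtain U where U: "U \<in> \<U>" "U \<subseteq> S"
      using S(1,2) assms(5) unfolding open_nhds_base_def by blast
    have "y \<in> closed_convex_hull (f ` (U - {}))"
      using y U(1) by blast
    with S(3)[of U] U(2) show False by simp
  qed
qed

end
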